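(* Let $d>1$ be an odd integer and let $f\in\mathcal{H}(2,d)$ be sharp. Then for every even integer $j$ with $0\le j\le d-1$, the coefficient of $x^jy^{d-1-j}$ in $f$ is zero.
   Context: $\mathcal{H}(2,d)$ denotes the set of real polynomials $p(x,y)$ of degree exactly $d$ with nonnegative coefficients such that $p(x,y)=1$ whenever $x+y=1$. For a polynomial $p$, $N(p)$ is the number of distinct monomials with nonzero coefficient in $p$. A polynomial $p\in\mathcal{H}(2,d)$ is called sharp if $N(p)$ is minimal among all elements of $\mathcal{H}(2,d)$. *)

theory Defs
  imports "HOL-Computational_Algebra.Polynomial"
begin

text \<open>
  A polynomial $p(x,y)$ is represented by an element of \<^typ>\<open>real poly poly\<close>: the outer variable
  is $y$ and the coefficients are polynomials in $x$.
\<close>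

definition coeff2 :: "real poly poly \<Rightarrow> nat \<Rightarrow> nat \<Rightarrow> real" where
  "coeff2 p i j = coeff (coeff p j) i"

definition eval2 :: "real poly poly \<Rightarrow> real \<Rightarrow> real \<Rightarrow> real" where
  "eval2 p x y = poly (poly p [:y:]) x"

definition monomials2 :: "real poly poly \<Rightarrow> (nat \<times> nat) set" where
  "monomials2 p = {(i, j). coeff2 p i j \<noteq> 0}"

text \<open>As for \<^const>\<open>degree\<close>, the zero polynomial gets total degree \<open>0\<close>.\<close>

definition total_degree2 :: "real poly poly \<Rightarrow> nat" where
  "total_degree2 p = Max (insert 0 ((\<lambda>(i, j). i + j) ` monomials2 p))"

definition num_monomials :: "real poly poly \<Rightarrow> nat" where
  "num_monomials p = card (monomials2 p)"

definition H2 :: "nat \<Rightarrow> real poly poly set" where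
  "H2 d = {p. total_degree2 p = d \<and> (\<forall>i j. coeff2 p i j \<ge> 0) \<and>
              (\<forall>x y. x + y = 1 \<longrightarrow> eval2 p x y = 1)}"

definition sharp :: "nat \<Rightarrow> real poly poly \<Rightarrow> bool" where
  "sharp d p \<longleftrightarrow> p \<in> H2 d \<and> (\<forall>q \<in> H2 d. num_monomials p \<le> num_monomials q)"

text \<open>Finiteness of the support, so that \<^const>\<open>Max\<close> and \<^const>\<open>card\<close> above are meaningful, and
  agreement of evaluation with the coefficients.\<close>

lemma finite_monomials2: "finite (monomials2 p)"
proof (rule finite_subset)
  show "monomials2 p \<subseteq> (\<Union>j\<le>degree p. (\<lambda>i. (i, j)) ` {..degree (coeff p j)})"
  proof
    fix m assume "m \<in> monomials2 p"
    then obtain i j where m: "m = (i, j)" and nz: "coeff (coeff p j) i \<noteq> 0"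
      by (auto simp: monomials2_def coeff2_def)
    from nz have "coeff p j \<noteq> 0" by auto
    then have "j \<le> degree p" by (rule le_degree)
    moreover from nz have "i \<le> degree (coeff p j)" by (rule le_degree)
    ultimately show "m \<in> (\<Union>j\<le>degree p. (\<lambda>i. (i, j)) ` {..degree (coeff p j)})"
      using m by auto
  qed
qed auto

lemma eval2_altdef:
  "eval2 p x y = (\<Sum>j\<le>degree p. \<Sum>i\<le>degree (coeff p j). coeff2 p i j * x ^ i * y ^ j)"
proof -
  have "eval2 p x y = (\<Sum>j\<le>degree p. poly (coeff p j) x * y ^ j)"
    unfolding eval2_def by (subst poly_altdef) (simp add: poly_sum)
  then show ?thesis
    by (simp add: coeff2_def poly_altdef sum_distrib_right)
qed

end

theory Submission
  imports Defs
begin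

text \<open>
  Write \<open>f - 1 = (x + y - 1) q\<close> and arrange the coefficients of \<open>f\<close> and \<open>q\<close> in rows \<open>i + j = k\<close>.
  Below row \<open>0\<close>, the \<open>q\<close>-entries satisfy Pascal's rule up to the subtraction of the nonnegative
  coefficients of \<open>f\<close>. Give every entry of row \<open>d\<close> of \<open>q\<close>, which vanishes, an alternating sign
  (\<open>d\<close> sign changes) and propagate the signs to row \<open>0\<close> (no sign change), respecting the
  signs of nonzero entries. A monomial of \<open>f\<close> allows one row to lose at most two sign changes, only
  one if it sits at an end of the row, and none if it sits at a positive sign. Since \<open>f\<close> has
  two pure monomials (or a constant term), \<open>d \<le> 2 N(f) - 2\<close>, and as D'Angelo's polynomials give
  \<open>2 N(f) \<le> d + 3\<close> for sharp \<open>f\<close>, at most one sign change may be wasted. Hence no monomial can sit at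
  an inner positive position: as row \<open>d\<close> may alternate in either way, \<open>f\<close> has top part
  \<open>c (x\<^sup>d + y\<^sup>d)\<close>. So the last row of \<open>q\<close> is \<open>c\<close> times an alternating row, positive at even \<open>i\<close>, and
  a monomial of \<open>f\<close> there would again waste too many sign changes.
\<close>

section \<open>Sign changes in adjacent rows\<close>

definition sign_changes :: "(nat \<Rightarrow> bool) \<Rightarrow> nat \<Rightarrow> nat" where
  "sign_changes s n = (\<Sum>a<n. of_bool (s a \<noteq> s (Suc a)))"

definition signs_of :: "(nat \<Rightarrow> bool) \<Rightarrow> (nat \<Rightarrow> real) \<Rightarrow> nat \<Rightarrow> bool" where
  "signs_of s r n \<longleftrightarrow> (\<forall>a\<le>n. (r a > 0 \<longrightarrow> s a) \<and> (r a < 0 \<longrightarrow> \<not> s a))"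

definition end_weight :: "nat \<Rightarrow> nat \<Rightarrow> nat" where
  "end_weight n a = (if a = 0 \<or> a = n then 1 else 2)"

lemma sign_changes_alternating:
  "(\<And>a. a < n \<Longrightarrow> s a \<noteq> s (Suc a)) \<Longrightarrow> sign_changes s n = n"
  by (simp add: sign_changes_def)

text \<open>A row whose signs are all copied from upper neighbours cannot change sign more often
  than the row above. A position in \<open>E\<close> copies nothing and adds at most one change on
  each side.\<close>

lemma sign_changes_le_row_above:
  assumes first: "s 0 = s' 0 \<or> 0 \<in> E"
    and inner: "\<And>a. a < n \<Longrightarrow> s (Suc a) = s' a \<or> s (Suc a) = s' (Suc a) \<or> Suc a \<in> E"
    and last: "s (Suc n) = s' n \<or> Suc n \<in> E"
  shows "sign_changes s (Suc n) \<le>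
    sign_changes s' n + (\<Sum>a\<le>Suc n. if a \<in> E then end_weight (Suc n) a else 0)"
proof -
  \<comment> \<open>The indicator of \<open>s m \<noteq> s' m\<close> is the potential that lets the scan along the two rows telescope.\<close>
  have scan: "sign_changes s m + of_bool (s m \<noteq> s' m) \<le>
      sign_changes s' m + (\<Sum>a\<le>m. if a \<in> E then end_weight (Suc n) a else 0)" if "m \<le> n" for m
    using that
  proof (induction m)
    case 0
    then show ?case
      using first by (auto simp: sign_changes_def end_weight_def)
  next
    case (Suc m)
    have "of_bool (s m \<noteq> s (Suc m)) + of_bool (s (Suc m) \<noteq> s' (Suc m)) \<le>
        of_bool (s m \<noteq> s' m) + of_bool (s' m \<noteq> s' (Suc m)) +
        (if Suc m \<in> E then end_weight (Suc n) (Suc m) else 0)"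
      using inner[of m] Suc.prems by (auto simp: end_weight_def of_bool_def)
    then show ?case
      using Suc by (simp add: sign_changes_def)
  qed
  have "of_bool (s n \<noteq> s (Suc n)) \<le>
      of_bool (s n \<noteq> s' n) + (if Suc n \<in> E then end_weight (Suc n) (Suc n) else 0)"
    using last by (auto simp: end_weight_def)
  then show ?thesis
    using scan[of n] by (simp add: sign_changes_def)
qed

text \<open>As \<open>t\<close> is nonnegative, a positive sign forces the two upper entries to have
  a nonnegative sum; a negative sign forces a nonpositive sum unless \<open>t\<close> is nonzero
  there.\<close>

lemma sign_changes_row_step:
  fixes r r' t :: "nat \<Rightarrow> real"
  assumes first: "r' 0 + t 0 = r 0"
    and step: "\<And>a. a \<le> n \<Longrightarrow> r' (Suc a) + t (Suc a) = r a + r (Suc a)"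
    and outside: "r (Suc n) = 0"
    and nonneg: "\<And>a. t a \<ge> 0"
    and nonzero: "\<exists>a\<le>n. r a \<noteq> 0"
    and s: "signs_of s r' (Suc n)"
  obtains s' where "signs_of s' r n"
    "sign_changes s (Suc n) \<le> sign_changes s' n +
       (\<Sum>a\<le>Suc n. if t a \<noteq> 0 \<and> \<not> s a then end_weight (Suc n) a else 0)"
proof -
  \<comment> \<open>Zeros of row \<open>r\<close> borrow a sign from below; those in the initial block of zeros must look
    straight down and all others diagonally, so that both ends of the row are served.\<close>
  define s' where "s' a = (if r a > 0 then True else if r a < 0 then False
    else if \<forall>b\<le>a. r b = 0 then s a else s (Suc a))" for a
  define E where "E = {a. t a \<noteq> 0 \<and> \<not> s a}"
  have pos: "r' a > 0 \<Longrightarrow> s a" and neg: "r' a < 0 \<Longrightarrow> \<not> s a" if "a \<le> Suc n" for a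
    using s that by (auto simp: signs_of_def)
  have s'_pos: "r a > 0 \<Longrightarrow> s' a" and s'_neg: "r a < 0 \<Longrightarrow> \<not> s' a" for a
    by (auto simp: s'_def)
  have t_pos: "s a \<Longrightarrow> a \<notin> E" and t_zero: "\<not> s a \<Longrightarrow> a \<notin> E \<Longrightarrow> t a = 0" for a
    by (auto simp: E_def)
  have first': "s 0 = s' 0 \<or> 0 \<in> E"
  proof (cases "r 0 = 0")
    case True
    then show ?thesis by (simp add: s'_def)
  next
    case False
    show ?thesis
      using first pos[of 0] neg[of 0] s'_pos[of 0] s'_neg[of 0] t_zero[of 0] nonneg[of 0] False
      by (cases "s 0"; cases "r 0 > 0") force+
  qed
  have inner': "s (Suc a) = s' a \<or> s (Suc a) = s' (Suc a) \<or> Suc a \<in> E" if "a < n" for a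
  proof (cases "r a = 0 \<and> r (Suc a) = 0")
    case True
    \<comment> \<open>Adjacent zeros lie both in the initial block or both outside it; either way
      one of them borrows from \<open>s (Suc a)\<close>.\<close>
    then show ?thesis by (auto simp: s'_def le_Suc_eq)
  next
    case False
    have eq: "r' (Suc a) + t (Suc a) = r a + r (Suc a)"
      using step[of a] that by simp
    show ?thesis
    proof (cases "s (Suc a)")
      case True
      then have "r a + r (Suc a) \<ge> 0"
        using eq nonneg[of "Suc a"] neg[of "Suc a"] that by force
      then have "r a > 0 \<or> r (Suc a) > 0"
        using False by linarith
      then show ?thesis
        using True s'_pos by auto
    next
      case neg: False
      show ?thesis
      proof (cases "Suc a \<in> E")
        case nE: False
        then have "r a + r (Suc a) \<le> 0"
          using eq t_zero[of "Suc a"] pos[of "Suc a"] that neg by force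
        then have "r a < 0 \<or> r (Suc a) < 0"
          using False by linarith
        then show ?thesis
          using neg s'_neg by auto
      qed auto
    qed
  qed
  have last': "s (Suc n) = s' n \<or> Suc n \<in> E"
  proof (cases "r n = 0")
    case True
    \<comment> \<open>By \<open>nonzero\<close>, a zero last entry lies outside the initial block
      and borrows from \<open>s (Suc n)\<close>.\<close>
    then show ?thesis using nonzero by (auto simp: s'_def)
  next
    case False
    have "r' (Suc n) + t (Suc n) = r n"
      using step[of n] outside by simp
    then show ?thesis
      using pos[of "Suc n"] neg[of "Suc n"] s'_pos[of n] s'_neg[of n] t_zero[of "Suc n"]
        nonneg[of "Suc n"] False
      by (cases "s (Suc n)"; cases "r n > 0") force+
  qed
  show ?thesis
  proof
    show "signs_of s' r n"
      by (simp add: signs_of_def s'_pos s'_neg)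
    show "sign_changes s (Suc n) \<le> sign_changes s' n +
       (\<Sum>a\<le>Suc n. if t a \<noteq> 0 \<and> \<not> s a then end_weight (Suc n) a else 0)"
      using sign_changes_le_row_above[OF first' inner' last'] by (simp add: E_def)
  qed
qed

section \<open>Coefficient triangles and the weight bound\<close>

text \<open>\<open>p k a\<close> and \<open>q k a\<close> stand for the coefficients of x^a y^(k-a)
  in f and q, where f = 1 + (x + y - 1) q.\<close>

locale coefficient_triangle =
  fixes p q :: "nat \<Rightarrow> nat \<Rightarrow> real" and n :: nat
  assumes p_nonneg: "p k a \<ge> 0"
    and q_first: "q (Suc k) 0 + p (Suc k) 0 = q k 0"
    and q_step: "a \<le> k \<Longrightarrow> q (Suc k) (Suc a) + p (Suc k) (Suc a) = q k a + q k (Suc a)"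
    and q_outside: "k < a \<Longrightarrow> q k a = 0"
    and q_top: "q (Suc n) a = 0"
    and p_top: "\<exists>a\<le>Suc n. p (Suc n) a \<noteq> 0"
begin

definition row_weight :: "nat \<Rightarrow> nat" where
  "row_weight k = (\<Sum>a\<le>k. if p k a \<noteq> 0 then end_weight k a else 0)"

definition weight :: "nat \<Rightarrow> nat" where
  "weight m = (\<Sum>k<m. row_weight (Suc k))"

lemma weight_Suc: "weight (Suc m) = weight m + row_weight (Suc m)"
  by (simp add: weight_def)

lemma q_nonpos_below:
  assumes "\<And>a. q k a \<le> 0" and "k \<le> m"
  shows "q m a \<le> 0"
  using assms(2)
proof (induction m arbitrary: a rule: dec_induct)
  case base
  show ?case by (rule assms)
next
  case (step m)
  show ?case
  proof (cases a)
    case 0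
    then show ?thesis
      using q_first[of m] p_nonneg[of "Suc m" 0] step.IH[of 0] by simp
  next
    case (Suc b)
    show ?thesis
    proof (cases "b \<le> m")
      case True
      then show ?thesis
        using Suc q_step[of b m] p_nonneg[of "Suc m" "Suc b"] step.IH[of b] step.IH[of "Suc b"]
        by simp
    next
      case False
      then show ?thesis
        using Suc q_outside[of "Suc m" a] by simp
    qed
  qed
qed

text \<open>A vanishing row would make all later rows of \<open>q\<close> nonpositive, and Pascal's
  rule would then make \<open>p (Suc n)\<close> nonpositive, hence zero.\<close>

lemma q_row_nonzero:
  assumes "k \<le> n"
  shows "\<exists>a\<le>k. q k a \<noteq> 0"
proof (rule ccontr)
  assume "\<not> ?thesis"
  then have "q k a \<le> 0" for a
    using q_outside[of k a] by (cases "a \<le> k") auto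
  then have n: "q n a \<le> 0" for a
    using assms q_nonpos_below by blast
  obtain a where a: "a \<le> Suc n" "p (Suc n) a \<noteq> 0"
    using p_top by blast
  have "p (Suc n) a \<le> 0"
  proof (cases a)
    case 0
    then show ?thesis using q_first[of n] q_top[of 0] n[of 0] by simp
  next
    case (Suc b)
    then show ?thesis
      using q_step[of b n] q_top[of a] n[of b] n[of a] a by simp
  qed
  then show False
    using a p_nonneg[of "Suc n" a] by simp
qed

lemma sign_changes_descend:
  assumes "k \<le> n" and "signs_of s (q (Suc k)) (Suc k)"
  obtains s' where "signs_of s' (q k) k"
    "sign_changes s (Suc k) \<le> sign_changes s' k +
       (\<Sum>a\<le>Suc k. if p (Suc k) a \<noteq> 0 \<and> \<not> s a then end_weight (Suc k) a else 0)"
  by (rule sign_changes_row_step[of "q (Suc k)" "p (Suc k)" "q k" k s])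
    (simp_all add: assms q_first q_step q_outside p_nonneg q_row_nonzero that)

lemma sign_changes_le_weight:
  "k \<le> Suc n \<Longrightarrow> signs_of s (q k) k \<Longrightarrow> sign_changes s k \<le> weight k"
proof (induction k arbitrary: s)
  case 0
  then show ?case by (simp add: sign_changes_def)
next
  case (Suc k)
  obtain s' where s': "signs_of s' (q k) k"
    "sign_changes s (Suc k) \<le> sign_changes s' k +
       (\<Sum>a\<le>Suc k. if p (Suc k) a \<noteq> 0 \<and> \<not> s a then end_weight (Suc k) a else 0)"
    using sign_changes_descend[of k s] Suc.prems by auto
  have "(\<Sum>a\<le>Suc k. if p (Suc k) a \<noteq> 0 \<and> \<not> s a then end_weight (Suc k) a else 0)
      \<le> row_weight (Suc k)"
    unfolding row_weight_def by (intro sum_mono) auto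
  then show ?case
    using s' Suc by (fastforce simp: weight_Suc)
qed

text \<open>A monomial at a positive sign is not charged in the descent, so its whole weight is left
  over.\<close>

lemma sign_changes_wasted:
  assumes "k \<le> n" and s: "signs_of s (q (Suc k)) (Suc k)"
    and b: "b \<le> Suc k" "p (Suc k) b \<noteq> 0" "s b"
  shows "sign_changes s (Suc k) + end_weight (Suc k) b \<le> weight (Suc k)"
proof -
  obtain s' where s': "signs_of s' (q k) k"
    "sign_changes s (Suc k) \<le> sign_changes s' k +
       (\<Sum>a\<le>Suc k. if p (Suc k) a \<noteq> 0 \<and> \<not> s a then end_weight (Suc k) a else 0)"
    using sign_changes_descend assms by blast
  have "(\<Sum>a\<le>Suc k. if p (Suc k) a \<noteq> 0 \<and> \<not> s a then end_weight (Suc k) a else 0)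
        + end_weight (Suc k) b
      = (\<Sum>a\<in>{..Suc k} - {b}. if p (Suc k) a \<noteq> 0 \<and> \<not> s a then end_weight (Suc k) a else 0)
        + end_weight (Suc k) b"
    using b by (subst sum.remove[of _ b]) auto
  also have "\<dots> \<le> (\<Sum>a\<in>{..Suc k} - {b}. if p (Suc k) a \<noteq> 0 then end_weight (Suc k) a else 0)
        + end_weight (Suc k) b"
    by (intro add_mono sum_mono) auto
  also have "\<dots> = row_weight (Suc k)"
    unfolding row_weight_def using b by (subst (2) sum.remove[of _ b]) auto
  finally show ?thesis
    using s' sign_changes_le_weight[of k s'] assms by (simp add: weight_Suc)
qed

lemma p_top_interior:
  assumes "weight (Suc n) \<le> n + 2" and "0 < b" "b < Suc n"
  shows "p (Suc n) b = 0"
proof (rule ccontr)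
  assume nz: "p (Suc n) b \<noteq> 0"
  \<comment> \<open>Any pattern suits the vanishing row \<open>Suc n\<close>; this one is positive
    at \<open>b\<close>. The waste of 2 exceeds the slack of 1.\<close>
  define s where "s a \<longleftrightarrow> even (a + b)" for a
  have "sign_changes s (Suc n) + end_weight (Suc n) b \<le> weight (Suc n)"
    using sign_changes_wasted[of n s b] nz assms by (simp add: signs_of_def s_def q_top)
  moreover have "sign_changes s (Suc n) = Suc n"
    by (rule sign_changes_alternating) (simp add: s_def)
  ultimately show False
    using assms by (simp add: end_weight_def)
qed

text \<open>Without inner top monomials, Pascal's rule makes neighbouring entries of
  \<open>q n\<close> cancel.\<close>

lemma q_top_alternating:
  assumes "weight (Suc n) \<le> n + 2" and "a \<le> n"
  shows "q n a = (-1) ^ a * p (Suc n) 0"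
  using assms(2)
proof (induction a)
  case 0
  then show ?case using q_first[of n] q_top[of 0] by simp
next
  case (Suc a)
  then show ?case
    using q_step[of a n] q_top[of "Suc a"] p_top_interior[of "Suc a"] assms(1) by simp
qed

lemma p_subtop_even_zero:
  assumes w: "weight (Suc n) \<le> n + 2" and "even n" "n > 0" "even j" "j \<le> n"
  shows "p n j = 0"
proof (rule ccontr)
  assume nz: "p n j \<noteq> 0"
  have "p (Suc n) 0 \<noteq> 0"
    using q_row_nonzero[of n] q_top_alternating[OF w] by auto
  then have c: "p (Suc n) 0 > 0"
    using p_nonneg[of "Suc n" 0] by simp
  \<comment> \<open>For even \<open>n\<close> the alternating row ends with the value it starts
    with.\<close>
  moreover have "p (Suc n) (Suc n) = p (Suc n) 0"
    using q_step[of n n] q_top[of "Suc n"] q_outside[of n "Suc n"] q_top_alternating[OF w, of n]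
      \<open>even n\<close> by simp
  ultimately have "2 = (\<Sum>a\<in>{0, Suc n}. if p (Suc n) a \<noteq> 0 then end_weight (Suc n) a else 0)"
    by (simp add: end_weight_def)
  also have "\<dots> \<le> row_weight (Suc n)"
    unfolding row_weight_def by (intro sum_mono2) auto
  finally have "row_weight (Suc n) \<ge> 2" .
  \<comment> \<open>The two pure top monomials use up 2; the \<open>n\<close> sign changes of row
    \<open>n\<close> need all the rest.\<close>
  then have w': "weight n \<le> n"
    using w by (simp add: weight_Suc)
  define s :: "nat \<Rightarrow> bool" where "s a \<longleftrightarrow> even a" for a
  have s: "signs_of s (q n) n"
    using c by (auto simp: signs_of_def s_def q_top_alternating[OF w] uminus_power_if
        mult_less_0_iff zero_less_mult_iff split: if_splits)
  obtain k where k: "n = Suc k"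
    using \<open>n > 0\<close> gr0_implies_Suc by blast
  have "k \<le> n" by (simp add: k)
  have "sign_changes s n + end_weight n j \<le> weight n"
    using sign_changes_wasted[of k s j] s nz assms k by (simp add: s_def)
  moreover have "sign_changes s n = n"
    by (rule sign_changes_alternating) (simp add: s_def)
  ultimately show False
    using w' by (simp add: end_weight_def split: if_splits)
qed

end

section \<open>D'Angelo's polynomials in odd degree\<close>

text \<open>
  The power sums \<open>\<alpha>\<^sup>n + \<beta>\<^sup>n\<close> with \<open>\<alpha> + \<beta> = x\<close> and \<open>\<alpha> \<beta> = - y\<close>; on the line \<open>x + y = 1\<close> the two
  roots are \<open>1\<close> and \<open>- y\<close>.
\<close>

fun dangelo :: "nat \<Rightarrow> real poly poly" where
  "dangelo 0 = [:[:2:]:]"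
| "dangelo (Suc 0) = [:[:0, 1:]:]"
| "dangelo (Suc (Suc n)) = [:[:0, 1:]:] * dangelo (Suc n) + [:0, 1:] * dangelo n"

lemma coeff2_dangelo_Suc_Suc:
  "coeff2 (dangelo (Suc (Suc n))) i j =
     (if i = 0 then 0 else coeff2 (dangelo (Suc n)) (i - 1) j) +
     (if j = 0 then 0 else coeff2 (dangelo n) i (j - 1))"
  by (simp add: coeff2_def coeff_pCons split: nat.split)

lemma coeff2_dangelo_0: "coeff2 (dangelo 0) i j = (if i = 0 \<and> j = 0 then 2 else 0)"
  by (auto simp: coeff2_def coeff_pCons split: nat.split)

lemma coeff2_dangelo_1: "coeff2 (dangelo (Suc 0)) i j = (if i = 1 \<and> j = 0 then 1 else 0)"
  by (auto simp: coeff2_def coeff_pCons split: nat.split)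

lemma coeff2_dangelo_nonneg: "coeff2 (dangelo n) i j \<ge> 0"
  by (induction n arbitrary: i j rule: dangelo.induct)
    (simp_all only: coeff2_dangelo_Suc_Suc coeff2_dangelo_0 coeff2_dangelo_1, auto)

lemma coeff2_dangelo_support: "coeff2 (dangelo n) i j \<noteq> 0 \<Longrightarrow> i + 2 * j = n"
proof (induction n arbitrary: i j rule: dangelo.induct)
  case (3 n)
  from "3.prems" consider "i \<noteq> 0" "coeff2 (dangelo (Suc n)) (i - 1) j \<noteq> 0"
    | "j \<noteq> 0" "coeff2 (dangelo n) i (j - 1) \<noteq> 0"
    unfolding coeff2_dangelo_Suc_Suc
    by (cases "i = 0 \<or> coeff2 (dangelo (Suc n)) (i - 1) j = 0") (auto split: if_splits)
  then show ?case
    using "3.IH"(1)[of "i - 1" j] "3.IH"(2)[of i "j - 1"] by cases auto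
qed (auto simp only: coeff2_dangelo_0 coeff2_dangelo_1 split: if_splits)

lemma eval2_dangelo:
  assumes "x + y = 1"
  shows "eval2 (dangelo n) x y = 1 + (- y) ^ n"
proof -
  have x: "x = 1 - y" using assms by simp
  show ?thesis
  proof (induction n rule: dangelo.induct)
    case (3 n)
    have "eval2 (dangelo (Suc (Suc n))) x y
        = x * eval2 (dangelo (Suc n)) x y + y * eval2 (dangelo n) x y"
      by (simp add: eval2_def)
    also have "\<dots> = 1 + (- y) ^ Suc (Suc n)"
      unfolding 3 by (simp add: x algebra_simps)
    finally show ?case .
  qed (auto simp: eval2_def x)
qed

text \<open>For odd \<open>d\<close> the term y^d cancels the (-y)^d left over on the line.\<close>

definition dangelo_sharp :: "nat \<Rightarrow> real poly poly" where
  "dangelo_sharp d = dangelo d + monom 1 d"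

lemma coeff2_dangelo_sharp:
  "coeff2 (dangelo_sharp d) i j = coeff2 (dangelo d) i j + (if i = 0 \<and> j = d then 1 else 0)"
  by (auto simp: dangelo_sharp_def coeff2_def coeff_1)

lemma monomials2_dangelo_sharp:
  "monomials2 (dangelo_sharp d) \<subseteq> insert (0, d) ((\<lambda>j. (d - 2 * j, j)) ` {..d div 2})"
proof
  fix m assume "m \<in> monomials2 (dangelo_sharp d)"
  then obtain i j where m: "m = (i, j)" "coeff2 (dangelo_sharp d) i j \<noteq> 0"
    by (auto simp: monomials2_def)
  then have "m = (0, d) \<or> i + 2 * j = d"
    using coeff2_dangelo_support[of d i j] by (auto simp: coeff2_dangelo_sharp split: if_splits)
  then show "m \<in> insert (0, d) ((\<lambda>j. (d - 2 * j, j)) ` {..d div 2})"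
    using m by (auto simp: image_iff)
qed

lemma num_monomials_dangelo_sharp: "num_monomials (dangelo_sharp d) \<le> d div 2 + 2"
proof -
  have "num_monomials (dangelo_sharp d) \<le> card (insert (0, d) ((\<lambda>j. (d - 2 * j, j)) ` {..d div 2}))"
    unfolding num_monomials_def by (intro card_mono monomials2_dangelo_sharp) auto
  also have "\<dots> \<le> Suc (card ((\<lambda>j. (d - 2 * j, j)) ` {..d div 2}))"
    by (rule card_insert_le_m1) auto
  also have "\<dots> \<le> Suc (card {..d div 2})"
    by (intro Suc_le_mono[THEN iffD2] card_image_le) auto
  finally show ?thesis by simp
qed

lemma dangelo_sharp_in_H2:
  assumes "odd d"
  shows "dangelo_sharp d \<in> H2 d"
proof -
  have "coeff2 (dangelo_sharp d) 0 d \<noteq> 0"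
    using coeff2_dangelo_nonneg[of d 0 d] by (simp add: coeff2_dangelo_sharp)
  then have "(0, d) \<in> monomials2 (dangelo_sharp d)"
    by (simp add: monomials2_def)
  moreover have "i + j \<le> d" if "(i, j) \<in> monomials2 (dangelo_sharp d)" for i j
    using monomials2_dangelo_sharp that by fastforce
  ultimately have "total_degree2 (dangelo_sharp d) = d"
    unfolding total_degree2_def
    by (intro Max_eqI) (auto intro: finite_monomials2 simp: image_iff intro!: bexI[of _ "(0, d)"])
  moreover have "eval2 (dangelo_sharp d) x y = 1" if "x + y = 1" for x y
    using eval2_dangelo[OF that, of d] assms
    by (simp add: dangelo_sharp_def eval2_def poly_monom)
  ultimately show ?thesis
    by (simp add: H2_def coeff2_dangelo_sharp coeff2_dangelo_nonneg)
qed

section \<open>Division by x + y - 1\<close>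

lemma poly_poly_eq_eval: "poly (poly f r) x = poly (poly f [:poly r x:]) x"
  by (induction f) auto

text \<open>Substituting y = 1 - x kills f - 1, so the factor theorem in the outer variable y gives
  the divisor y - (1 - x).\<close>

lemma constant_on_line_quotient:
  assumes "\<And>x y. x + y = 1 \<Longrightarrow> eval2 f x y = 1"
  obtains q where "f = 1 + [:[:-1, 1:], 1:] * q"
proof -
  have "poly (poly f [:1, -1:]) x = poly 1 x" for x
    using assms[of x "1 - x"] poly_poly_eq_eval[of f "[:1, -1:]" x] by (simp add: eval2_def)
  then have "poly f [:1, -1:] = 1"
    by (subst poly_eq_poly_eq_iff[symmetric]) (simp add: fun_eq_iff)
  then have "[:- [:1, -1:], 1:] dvd f - 1"
    by (subst poly_eq_0_iff_dvd[symmetric]) simp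
  then obtain q where "f - 1 = [:[:-1, 1:], 1:] * q"
    by (auto elim: dvdE)
  then show ?thesis
    by (intro that[of q]) (simp add: algebra_simps)
qed

lemma coeff2_quotient:
  assumes "f = 1 + [:[:-1, 1:], 1:] * q"
  shows "coeff2 f i j + coeff2 q i j =
    (if i = 0 \<and> j = 0 then 1 else 0) +
    (if i = 0 then 0 else coeff2 q (i - 1) j) + (if j = 0 then 0 else coeff2 q i (j - 1))"
  unfolding assms by (cases i; cases j) (auto simp: coeff2_def coeff_pCons coeff_1)

lemma coeff2_above_total_degree: "total_degree2 f < i + j \<Longrightarrow> coeff2 f i j = 0"
proof (rule ccontr)
  assume less: "total_degree2 f < i + j" and "coeff2 f i j \<noteq> 0"
  then have "i + j \<in> insert 0 ((\<lambda>(i, j). i + j) ` monomials2 f)"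
    by (force simp: monomials2_def)
  then have "i + j \<le> total_degree2 f"
    unfolding total_degree2_def by (intro Max_ge) (auto intro: finite_monomials2)
  with less show False by simp
qed

lemma total_degree2_attained:
  assumes "total_degree2 f > 0"
  obtains i j where "i + j = total_degree2 f" "coeff2 f i j \<noteq> 0"
proof -
  have "total_degree2 f \<in> insert 0 ((\<lambda>(i, j). i + j) ` monomials2 f)"
    unfolding total_degree2_def by (intro Max_in) (auto intro: finite_monomials2)
  then show ?thesis
    using assms that by (auto simp: monomials2_def)
qed

lemma coeff2_quotient_above:
  assumes f: "f = 1 + [:[:-1, 1:], 1:] * q" and deg: "total_degree2 f \<le> i + j"
  shows "coeff2 q i j = 0"
proof -
  \<comment> \<open>Descending induction from just above the degree of \<open>q\<close>: once the
    next row of \<open>q\<close> is zero, neighbours in row \<open>k\<close> cancel and the entry at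
    \<open>i = 0\<close> vanishes.\<close>
  have below: "total_degree2 f \<le> k \<longrightarrow> (\<forall>i j. i + j = k \<longrightarrow> coeff2 q i j = 0)"
    if "k \<le> Suc (total_degree2 q)" for k
    using that
  proof (induction k rule: inc_induct)
    case base
    then show ?case by (simp add: coeff2_above_total_degree)
  next
    case (step k)
    show ?case
    proof (intro impI allI)
      fix i j assume k: "total_degree2 f \<le> k" and "i + j = k"
      from this(2) show "coeff2 q i j = 0"
      proof (induction i arbitrary: j)
        case 0
        then show ?case
          using coeff2_quotient[OF f, of 0 "Suc j"] step.IH k
            coeff2_above_total_degree[of f 0 "Suc j"] by simp
      next
        case (Suc i)
        then show ?case
          using coeff2_quotient[OF f, of "Suc i" "Suc j"] step.IH k
            coeff2_above_total_degree[of f "Suc i" "Suc j"] Suc.IH[of "Suc j"] by simp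
      qed
    qed
  qed
  show ?thesis
  proof (cases "i + j \<le> Suc (total_degree2 q)")
    case True
    then show ?thesis using below deg by blast
  next
    case False
    then show ?thesis by (simp add: coeff2_above_total_degree)
  qed
qed

section \<open>From polynomials to triangles\<close>

text \<open>For \<open>a > k\<close>, truncated subtraction alone would yield the coefficient of x^a
  instead of 0.\<close>

definition antidiag :: "real poly poly \<Rightarrow> nat \<Rightarrow> nat \<Rightarrow> real" where
  "antidiag f k a = (if a \<le> k then coeff2 f a (k - a) else 0)"

lemma coefficient_triangle_antidiag:
  assumes H: "f \<in> H2 (Suc n)" and f: "f = 1 + [:[:-1, 1:], 1:] * q"
  shows "coefficient_triangle (antidiag f) (antidiag q) n"
proof
  have deg: "total_degree2 f = Suc n" using H by (simp add: H2_def)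
  show "antidiag f k a \<ge> 0" for k a
    using H by (simp add: H2_def antidiag_def)
  show "antidiag q (Suc k) 0 + antidiag f (Suc k) 0 = antidiag q k 0" for k
    using coeff2_quotient[OF f, of 0 "Suc k"] by (simp add: antidiag_def)
  show "antidiag q (Suc k) (Suc a) + antidiag f (Suc k) (Suc a) = antidiag q k a + antidiag q k (Suc a)"
    if "a \<le> k" for a k
    using coeff2_quotient[OF f, of "Suc a" "k - a"] that by (auto simp: antidiag_def)
  show "antidiag q k a = 0" if "k < a" for k a
    using that by (simp add: antidiag_def)
  show "antidiag q (Suc n) a = 0" for a
    using coeff2_quotient_above[OF f, of a "Suc n - a"] deg by (simp add: antidiag_def)
  obtain i j where "i + j = Suc n" "coeff2 f i j \<noteq> 0"
    using total_degree2_attained[of f] deg by auto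
  then show "\<exists>a\<le>Suc n. antidiag f (Suc n) a \<noteq> 0"
    by (intro exI[of _ i]) (auto simp: antidiag_def simp flip: \<open>i + j = Suc n\<close>)
qed

text \<open>Agrees with \<open>end_weight\<close> in positive rows; the constant weighs 0, as
  \<open>weight\<close> omits row 0.\<close>

definition monomial_weight :: "nat \<times> nat \<Rightarrow> nat" where
  "monomial_weight m = (if fst m = 0 then 0 else 1) + (if snd m = 0 then 0 else 1)"

text \<open>Each monomial weighs at most 2. The values at (1,0) and (0,1) force a power of x and a
  power of y; these fall short by 1 each, a constant by 2.\<close>

lemma sum_monomial_weight_le:
  assumes "\<And>x y. x + y = 1 \<Longrightarrow> eval2 f x y = 1"
  shows "sum monomial_weight (monomials2 f) + 2 \<le> 2 * num_monomials f"
proof -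
  let ?M = "monomials2 f"
  have "\<exists>i. coeff2 f i 0 \<noteq> 0"
  proof (rule ccontr)
    assume "\<not> ?thesis"
    then have "coeff2 f i j * 1 ^ i * 0 ^ j = 0" for i j
      by (cases j) auto
    then have "eval2 f 1 0 = 0" unfolding eval2_altdef by (intro sum.neutral ballI)
    then show False using assms[of 1 0] by simp
  qed
  then obtain i where i: "(i, 0) \<in> ?M" by (auto simp: monomials2_def)
  have "\<exists>j. coeff2 f 0 j \<noteq> 0"
  proof (rule ccontr)
    assume "\<not> ?thesis"
    then have "coeff2 f i j * 0 ^ i * 1 ^ j = 0" for i j
      by (cases i) auto
    then have "eval2 f 0 1 = 0" unfolding eval2_altdef by (intro sum.neutral ballI)
    then show False using assms[of 0 1] by simp
  qed
  then obtain j where j: "(0, j) \<in> ?M" by (auto simp: monomials2_def)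
  have "2 \<le> (\<Sum>m\<in>{(i, 0), (0, j)}. 2 - monomial_weight m)"
    by (cases "i = 0 \<and> j = 0") (auto simp: monomial_weight_def)
  also have "\<dots> \<le> (\<Sum>m\<in>?M. 2 - monomial_weight m)"
    using i j by (intro sum_mono2) (auto intro: finite_monomials2)
  finally have "sum monomial_weight ?M + 2
      \<le> (\<Sum>m\<in>?M. monomial_weight m + (2 - monomial_weight m))"
    by (simp add: sum.distrib)
  also have "\<dots> = (\<Sum>m\<in>?M. 2)"
    by (intro sum.cong) (auto simp: monomial_weight_def)
  finally show ?thesis by (simp add: num_monomials_def)
qed

lemma (in coefficient_triangle) weight_antidiag:
  assumes p: "p = antidiag f" and deg: "total_degree2 f = Suc n"
  shows "weight (Suc n) = sum monomial_weight (monomials2 f)"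
proof -
  let ?M = "monomials2 f"
  let ?row = "\<lambda>k. sum monomial_weight {m \<in> ?M. fst m + snd m = k}"
  have row: "row_weight k = ?row k" if "k > 0" for k
  proof -
    have "row_weight k = (\<Sum>a\<in>{a. a \<le> k \<and> p k a \<noteq> 0}. end_weight k a)"
      unfolding row_weight_def by (subst sum.inter_filter[symmetric]) auto
    also have "\<dots> = ?row k"
      using that
      by (intro sum.reindex_bij_witness[of _ fst "\<lambda>a. (a, k - a)"])
        (auto simp: p antidiag_def monomials2_def monomial_weight_def end_weight_def)
    finally show ?thesis .
  qed
  have "?row 0 = 0"
    by (intro sum.neutral) (auto simp: monomial_weight_def)
  moreover have "sum monomial_weight ?M = (\<Sum>k\<le>Suc n. ?row k)"
    using coeff2_above_total_degree[of f] deg finite_monomials2[of f]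
    by (intro sum.group[symmetric]) (force simp: monomials2_def not_less[symmetric])+
  ultimately show ?thesis
    unfolding weight_def by (subst (asm) sum.atMost_Suc_shift)
      (simp add: row lessThan_Suc_atMost)
qed

theorem lemma3p4:
  fixes d j :: nat and f :: "real poly poly"
  assumes "d > 1" and "odd d"
    and "sharp d f"
    and "even j" and "j \<le> d - 1"
  shows "coeff2 f j (d - 1 - j) = 0"
proof -
  obtain n where d: "d = Suc n" and n: "n > 0" "even n"
    using assms by (cases d) auto
  have f: "f \<in> H2 (Suc n)" and line: "\<And>x y. x + y = 1 \<Longrightarrow> eval2 f x y = 1"
    and deg: "total_degree2 f = Suc n"
    using assms by (auto simp: sharp_def H2_def d)
  obtain q where q: "f = 1 + [:[:-1, 1:], 1:] * q"
    using constant_on_line_quotient[of f] line by blast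
  interpret coefficient_triangle "antidiag f" "antidiag q" n
    using f q by (rule coefficient_triangle_antidiag)
  have "num_monomials f \<le> num_monomials (dangelo_sharp d)"
    using assms dangelo_sharp_in_H2 by (auto simp: sharp_def)
  also have "\<dots> \<le> d div 2 + 2"
    by (rule num_monomials_dangelo_sharp)
  \<comment> \<open>As \<open>n\<close> is even, \<open>d div 2 = n div 2\<close>.\<close>
  finally have "2 * num_monomials f \<le> n + 4"
    using n d by (auto elim: evenE)
  then have "weight (Suc n) \<le> n + 2"
    using sum_monomial_weight_le[OF line] weight_antidiag[OF refl deg] by simp
  then have "antidiag f n j = 0"
    using p_subtop_even_zero n assms d by simp
  then show ?thesis
    using assms d by (simp add: antidiag_def)
qed

end
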